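(* Let $0<p<1$ be fixed, let $G=B(n_1,n_2,p)$ be the random bipartite graph with $n=n_1+n_2$ vertices, and let $N(n_1,n_2)$ be the number of groupies in $G$. Let $0\le\alpha\le 1$. Then for every $\epsilon>0$, $$P\left(\left|\frac{N(n_1,n_2)}{n}-\frac{1}{1+\alpha}\right|>\epsilon\right)\longrightarrow 0$$ as $n_1,n_2\to\infty$ with $\frac{n_1}{n_2}\to\alpha$ and $|n_1-n_2|\to\infty$ (i.e., along every sequence of pairs $(n_1,n_2)$ of positive integers satisfying these conditions).
   Context: $B(n_1,n_2,p)$ denotes the random bipartite graph with parts $P_1,P_2$ of sizes $n_1,n_2$ in which each of the $n_1n_2$ possible edges between $P_1$ and $P_2$ is present independently with probability $p$ (and there are no other edges). Groupie: let $G=(V,E)$ be a simple graph with $|V|=n$ and $|E|=e$. For $v\in V$ let $r(v)$ be the sum of the degrees of the neighbors of $v$. A non-isolated vertex $v$ is a groupie if the average degree of its neighbors is not less than the average degree of all vertices of $G$, i.e. $\frac{r(v)}{\deg(v)}\ge\frac{2e}{n}$. An isolated vertex $v$ is a groupie if and only if all vertices of $G$ are isolated. *)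

theory Defs
  imports "HOL-Probability.Probability"
begin

type_synonym 'a ugraph = "'a set \<times> 'a set set"

abbreviation verts :: "'a ugraph \<Rightarrow> 'a set" where "verts G \<equiv> fst G"
abbreviation edges :: "'a ugraph \<Rightarrow> 'a set set" where "edges G \<equiv> snd G"

definition simple_graph :: "'a ugraph \<Rightarrow> bool" where
  "simple_graph G \<longleftrightarrow>
     finite (verts G) \<and> (\<forall>e \<in> edges G. e \<subseteq> verts G \<and> card e = 2)"

definition neighbors :: "'a ugraph \<Rightarrow> 'a \<Rightarrow> 'a set" where
  "neighbors G v = {w \<in> verts G. {v, w} \<in> edges G}"

definition degree :: "'a ugraph \<Rightarrow> 'a \<Rightarrow> nat" where
  "degree G v = card (neighbors G v)"

definition neighbor_degree_sum :: "'a ugraph \<Rightarrow> 'a \<Rightarrow> nat" where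
  "neighbor_degree_sum G v = (\<Sum>w \<in> neighbors G v. degree G w)"

definition isolated :: "'a ugraph \<Rightarrow> 'a \<Rightarrow> bool" where
  "isolated G v \<longleftrightarrow> degree G v = 0"

definition groupie :: "'a ugraph \<Rightarrow> 'a \<Rightarrow> bool" where
  "groupie G v \<longleftrightarrow>
     (if isolated G v then \<forall>u \<in> verts G. isolated G u
      else real (neighbor_degree_sum G v) / real (degree G v)
             \<ge> 2 * real (card (edges G)) / real (card (verts G)))"

definition num_groupies :: "'a ugraph \<Rightarrow> nat" where
  "num_groupies G = card {v \<in> verts G. groupie G v}"

text \<open>The two parts are the two summands of a disjoint union; the Boolean
  \<open>f (i, j)\<close> says whether the edge between \<open>Inl i\<close> and \<open>Inr j\<close> is present.\<close>

definition bipartite_graph :: "nat \<Rightarrow> nat \<Rightarrow> (nat \<times> nat \<Rightarrow> bool) \<Rightarrow> (nat + nat) ugraph" where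
  "bipartite_graph n1 n2 f =
     ({..<n1} <+> {..<n2}, {{Inl i, Inr j} | i j. i < n1 \<and> j < n2 \<and> f (i, j)})"

definition random_bipartite :: "nat \<Rightarrow> nat \<Rightarrow> real \<Rightarrow> (nat + nat) ugraph pmf" where
  "random_bipartite n1 n2 p =
     map_pmf (bipartite_graph n1 n2)
       (Pi_pmf ({..<n1} \<times> {..<n2}) False (\<lambda>_. bernoulli_pmf p))"

lemma simple_graph_bipartite_graph: "simple_graph (bipartite_graph n1 n2 f)"
  by (auto simp: simple_graph_def bipartite_graph_def)

lemma simple_graph_random_bipartite:
  "G \<in> set_pmf (random_bipartite n1 n2 p) \<Longrightarrow> simple_graph G"
  by (auto simp: random_bipartite_def simple_graph_bipartite_graph)

end

theory Submission
  imports Defs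
begin

text \<open>
  Let \<open>v\<close> lie in a part of size \<open>a\<close>, let the other part have size \<open>b\<close>, and write
  \<open>n = a + b\<close>, \<open>d\<close> for the degree of \<open>v\<close>, \<open>e\<close> for the number of edges and \<open>r\<close> for the sum of
  the degrees of the neighbours of \<open>v\<close>.  The sign of \<open>n r - 2 e d\<close> decides whether \<open>v\<close> is a
  groupie.  This quantity equals
  \<open>d (n (1 - p) + p a (a - b) - 2 (e - a b p)) + n R\<close>, where \<open>R\<close> sums \<open>f (i', j) - p\<close> over the
  neighbours \<open>j\<close> of \<open>v\<close> and the vertices \<open>i'\<close> in the part of \<open>v\<close> other than \<open>v\<close>.  The second
  moments of \<open>d - b p\<close>, \<open>e - a b p\<close> and \<open>R\<close> are at most \<open>b\<close>, \<open>a b\<close> and \<open>a b\<close>, so by Chebyshev's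
  inequality the term \<open>d p a (a - b)\<close> dominates as soon as \<open>a\<close>, \<open>b\<close> and \<open>\<bar>a - b\<bar>\<close> are large.
  Hence almost all vertices of the larger part are groupies and almost none of the smaller part
  are; Markov's inequality for the number of exceptional vertices reduces the claim to
  \<open>max n1 n2 / (n1 + n2) \<longlonglongrightarrow> 1 / (1 + \<alpha>)\<close>.
\<close>

subsection \<open>Second moments of centred sums\<close>

abbreviation bernoulli_field :: "'a set \<Rightarrow> real \<Rightarrow> ('a \<Rightarrow> bool) pmf" where
  "bernoulli_field U p \<equiv> Pi_pmf U False (\<lambda>_. bernoulli_pmf p)"

lemma finite_set_bernoulli_field: "finite U \<Longrightarrow> finite (set_pmf (bernoulli_field U p))"
  by (subst set_Pi_pmf) (auto intro!: finite_PiE_dflt)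

text \<open>Resampling coordinate \<open>x\<close> alone leaves \<open>h\<close> fixed, while the
  centred factor averages to \<open>p * (1 - p) + (1 - p) * (0 - p) = 0\<close>.\<close>

lemma expectation_centred_times_independent:
  fixes h :: "('a \<Rightarrow> bool) \<Rightarrow> real"
  assumes U: "finite U" "x \<in> U" and p: "0 \<le> p" "p \<le> 1"
    and h: "\<And>f b. h (f(x := b)) = h f"
  shows "measure_pmf.expectation (bernoulli_field U p) (\<lambda>f. h f * (of_bool (f x) - p)) = 0"
proof -
  let ?Q = "bernoulli_field (U - {x}) p"
  have "bernoulli_field U p = bernoulli_field (insert x (U - {x})) p"
    using U by (simp add: insert_absorb)
  also have "\<dots> = bernoulli_pmf p \<bind> (\<lambda>y. map_pmf (\<lambda>f. f(x := y)) ?Q)"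
    using U by (subst Pi_pmf_insert') (auto simp: map_pmf_def)
  finally have "measure_pmf.expectation (bernoulli_field U p) (\<lambda>f. h f * (of_bool (f x) - p)) =
      (\<Sum>y\<in>UNIV. pmf (bernoulli_pmf p) y *\<^sub>R
        measure_pmf.expectation (map_pmf (\<lambda>f. f(x := y)) ?Q) (\<lambda>f. h f * (of_bool (f x) - p)))"
    using U by (simp only:) (subst pmf_expectation_bind[of UNIV], auto intro!: finite_set_bernoulli_field)
  also have "\<dots> = 0"
    using p by (simp add: UNIV_bool h)
  finally show ?thesis .
qed

text \<open>Chebyshev's inequality: the summands are pairwise uncorrelated and each has second
  moment at most 1. The weights may be random as long as they ignore the coordinates in
  \<open>A\<close>; the sum \<open>R\<close> requires this generality.\<close>

lemma weighted_centred_sum_tail: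
  fixes w :: "'a \<Rightarrow> ('a \<Rightarrow> bool) \<Rightarrow> real"
  assumes U: "finite U" "A \<subseteq> U" and p: "0 \<le> p" "p \<le> 1" and t: "t > 0"
    and w: "\<And>x y f b. x \<in> A \<Longrightarrow> y \<in> A \<Longrightarrow> w x (f(y := b)) = w x f"
    and w_le: "\<And>x f. x \<in> A \<Longrightarrow> \<bar>w x f\<bar> \<le> 1"
  shows "measure_pmf.prob (bernoulli_field U p)
           {f. \<bar>\<Sum>x\<in>A. w x f * (of_bool (f x) - p)\<bar> \<ge> t} \<le> real (card A) / t\<^sup>2"
proof -
  let ?M = "bernoulli_field U p"
  let ?E = "measure_pmf.expectation ?M"
  let ?Z = "\<lambda>x f. w x f * (of_bool (f x) - p)"
  have fA: "finite A" using U finite_subset by blast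
  have int [simp]: "integrable (measure_pmf ?M) F" for F :: "_ \<Rightarrow> real"
    by (intro integrable_measure_pmf_finite finite_set_bernoulli_field U)
  have off: "?E (\<lambda>f. ?Z x f * ?Z y f) = 0" if "x \<in> A" "y \<in> A" "x \<noteq> y" for x y
  proof -
    \<comment> \<open>Both weights ignore coordinate \<open>x\<close>, and so does the factor of
      \<open>y\<close>, since \<open>y\<close> differs from \<open>x\<close>.\<close>
    have "?E (\<lambda>f. (w x f * w y f * (of_bool (f y) - p)) * (of_bool (f x) - p)) = 0"
      by (rule expectation_centred_times_independent) (use that U p w in auto)
    thus ?thesis by (simp add: mult_ac)
  qed
  have Z_le: "?Z x f * ?Z x f \<le> 1" if "x \<in> A" for x f
  proof -
    have "\<bar>?Z x f\<bar> \<le> 1 * 1"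
      unfolding abs_mult using w_le[OF that] p by (intro mult_mono) auto
    hence "(?Z x f)\<^sup>2 \<le> 1" by (simp add: abs_square_le_1)
    thus ?thesis by (simp only: power2_eq_square)
  qed
  have diag: "?E (\<lambda>f. ?Z x f * ?Z x f) \<le> 1" if "x \<in> A" for x
    by (intro measure_pmf.integral_le_const int AE_I2 Z_le that)
  have "?E (\<lambda>f. (\<Sum>x\<in>A. ?Z x f)\<^sup>2) = (\<Sum>x\<in>A. \<Sum>y\<in>A. ?E (\<lambda>f. ?Z x f * ?Z y f))"
    unfolding power2_eq_square sum_product by (simp only: Bochner_Integration.integral_sum int)
  also have "\<dots> = (\<Sum>x\<in>A. \<Sum>y\<in>A. if y = x then ?E (\<lambda>f. ?Z x f * ?Z x f) else 0)"
    by (intro sum.cong refl) (auto simp: off)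
  also have "\<dots> \<le> (\<Sum>x\<in>A. 1)"
    using fA by (intro sum_mono) (auto simp only: sum.delta if_True intro: diag)
  finally have "?E (\<lambda>f. (\<Sum>x\<in>A. ?Z x f)\<^sup>2) \<le> real (card A)" by simp
  moreover have "measure_pmf.prob ?M {f \<in> space (measure_pmf ?M). \<bar>\<Sum>x\<in>A. ?Z x f\<bar> \<ge> t}
      \<le> ?E (\<lambda>f. (\<Sum>x\<in>A. ?Z x f)\<^sup>2) / t\<^sup>2"
    by (intro measure_pmf.second_moment_method) (use t in auto)
  ultimately show ?thesis
    by (simp, meson order_trans divide_right_mono zero_le_power2)
qed

subsection \<open>Groupies of a bipartite graph\<close>

text \<open>For an isolated vertex \<open>v\<close> the quantity \<open>Y\<close> is \<open>0\<close>, so neither conclusion applies to it.\<close>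

lemma groupie_by_sign:
  assumes "finite (verts G)" "v \<in> verts G"
  defines "Y \<equiv> real (card (verts G)) * real (neighbor_degree_sum G v)
                 - 2 * real (card (edges G)) * real (degree G v)"
  shows "Y > 0 \<Longrightarrow> groupie G v" and "Y < 0 \<Longrightarrow> \<not> groupie G v"
proof -
  have "card (verts G) > 0" using assms by (auto simp: card_gt_0_iff)
  moreover have "neighbor_degree_sum G v = 0" if "degree G v = 0"
    using that unfolding degree_def neighbor_degree_sum_def card_eq_0_iff by auto
  ultimately show "Y > 0 \<Longrightarrow> groupie G v" and "Y < 0 \<Longrightarrow> \<not> groupie G v"
    unfolding Y_def groupie_def isolated_def by (auto simp: field_simps)
qed

definition row_sum :: "(nat \<times> nat \<Rightarrow> bool) \<Rightarrow> nat \<Rightarrow> nat \<Rightarrow> real" where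
  "row_sum f b i = (\<Sum>j<b. of_bool (f (i, j)))"

definition total_sum :: "(nat \<times> nat \<Rightarrow> bool) \<Rightarrow> nat \<Rightarrow> nat \<Rightarrow> real" where
  "total_sum f a b = (\<Sum>i<a. \<Sum>j<b. of_bool (f (i, j)))"

text \<open>This is \<open>n r - 2 e d\<close> for row \<open>i\<close> of a 0/1 matrix with
  \<open>a\<close> rows and \<open>b\<close> columns. In this form the vertices of the second part
  are covered by transposing the matrix with \<open>prod.swap\<close>.\<close>

definition groupie_excess :: "(nat \<times> nat \<Rightarrow> bool) \<Rightarrow> nat \<Rightarrow> nat \<Rightarrow> nat \<Rightarrow> real" where
  "groupie_excess f a b i =
     real (a + b) * (\<Sum>j<b. of_bool (f (i, j)) * (\<Sum>i'<a. of_bool (f (i', j))))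
       - 2 * total_sum f a b * row_sum f b i"

lemma neighbors_bipartite_graph:
  "i < n1 \<Longrightarrow> neighbors (bipartite_graph n1 n2 f) (Inl i) = Inr ` {j \<in> {..<n2}. f (i, j)}"
  "j < n2 \<Longrightarrow> neighbors (bipartite_graph n1 n2 f) (Inr j) = Inl ` {i \<in> {..<n1}. f (i, j)}"
  by (auto simp: neighbors_def bipartite_graph_def doubleton_eq_iff)

lemma degree_bipartite_graph:
  "i < n1 \<Longrightarrow> degree (bipartite_graph n1 n2 f) (Inl i) = (\<Sum>j<n2. of_bool (f (i, j)))"
  "j < n2 \<Longrightarrow> degree (bipartite_graph n1 n2 f) (Inr j) = (\<Sum>i<n1. of_bool (f (i, j)))"
  by (auto simp: degree_def neighbors_bipartite_graph card_image sum.If_cases of_bool_def Int_def)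

lemma card_edges_bipartite_graph:
  "card (edges (bipartite_graph n1 n2 f)) = (\<Sum>i<n1. \<Sum>j<n2. of_bool (f (i, j)))"
proof -
  let ?P = "{x \<in> {..<n1} \<times> {..<n2}. f x}"
  have "edges (bipartite_graph n1 n2 f) = (\<lambda>(i, j). {Inl i, Inr j}) ` ?P"
    by (force simp: bipartite_graph_def)
  \<comment> \<open>The constructors \<open>Inl\<close> and \<open>Inr\<close> tell the two ends of
    an edge apart, so an unordered edge determines its pair.\<close>
  moreover have "inj_on (\<lambda>(i, j). {Inl i, Inr j} :: (nat + nat) set) ?P"
    by (auto simp: inj_on_def doubleton_eq_iff)
  ultimately have "card (edges (bipartite_graph n1 n2 f)) = card ?P"
    by (simp add: card_image)
  also have "\<dots> = (\<Sum>(i, j)\<in>{..<n1} \<times> {..<n2}. of_bool (f (i, j)))"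
    by (simp add: case_prod_unfold sum.If_cases of_bool_def Int_def)
  finally show ?thesis by (simp only: sum.cartesian_product)
qed

lemma neighbor_degree_sum_bipartite_graph:
  "i < n1 \<Longrightarrow> neighbor_degree_sum (bipartite_graph n1 n2 f) (Inl i) =
     (\<Sum>j<n2. of_bool (f (i, j)) * (\<Sum>i'<n1. of_bool (f (i', j))))"
  "j < n2 \<Longrightarrow> neighbor_degree_sum (bipartite_graph n1 n2 f) (Inr j) =
     (\<Sum>i<n1. of_bool (f (i, j)) * (\<Sum>j'<n2. of_bool (f (i, j'))))"
proof -
  assume "i < n1"
  hence "neighbor_degree_sum (bipartite_graph n1 n2 f) (Inl i) =
      (\<Sum>j | j \<in> {..<n2} \<and> f (i, j). \<Sum>i'<n1. of_bool (f (i', j)))"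
    by (simp add: neighbor_degree_sum_def neighbors_bipartite_graph sum.reindex degree_bipartite_graph)
  also have "\<dots> = (\<Sum>j<n2. of_bool (f (i, j)) * (\<Sum>i'<n1. of_bool (f (i', j))))"
    by (simp only: sum.inter_filter finite_lessThan) (intro sum.cong refl; simp)
  finally show "neighbor_degree_sum (bipartite_graph n1 n2 f) (Inl i) = \<dots>" .
next
  assume "j < n2"
  hence "neighbor_degree_sum (bipartite_graph n1 n2 f) (Inr j) =
      (\<Sum>i | i \<in> {..<n1} \<and> f (i, j). \<Sum>j'<n2. of_bool (f (i, j')))"
    by (simp add: neighbor_degree_sum_def neighbors_bipartite_graph sum.reindex degree_bipartite_graph)
  also have "\<dots> = (\<Sum>i<n1. of_bool (f (i, j)) * (\<Sum>j'<n2. of_bool (f (i, j'))))"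
    by (simp only: sum.inter_filter finite_lessThan) (intro sum.cong refl; simp)
  finally show "neighbor_degree_sum (bipartite_graph n1 n2 f) (Inr j) = \<dots>" .
qed

lemma verts_bipartite_graph: "verts (bipartite_graph n1 n2 f) = {..<n1} <+> {..<n2}"
  by (simp add: bipartite_graph_def)

lemma groupie_bipartite_graph_Inl:
  assumes "i < n1"
  shows "groupie_excess f n1 n2 i > 0 \<Longrightarrow> groupie (bipartite_graph n1 n2 f) (Inl i)"
    and "groupie_excess f n1 n2 i < 0 \<Longrightarrow> \<not> groupie (bipartite_graph n1 n2 f) (Inl i)"
  using groupie_by_sign[of "bipartite_graph n1 n2 f" "Inl i"] assms
  by (simp_all add: verts_bipartite_graph card_Plus card_edges_bipartite_graph InlI
      neighbor_degree_sum_bipartite_graph degree_bipartite_graph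
      groupie_excess_def total_sum_def row_sum_def)

lemma groupie_bipartite_graph_Inr:
  assumes "j < n2"
  shows "groupie_excess (f \<circ> prod.swap) n2 n1 j > 0 \<Longrightarrow> groupie (bipartite_graph n1 n2 f) (Inr j)"
    and "groupie_excess (f \<circ> prod.swap) n2 n1 j < 0 \<Longrightarrow> \<not> groupie (bipartite_graph n1 n2 f) (Inr j)"
proof -
  \<comment> \<open>Transposition preserves the number of edges.\<close>
  have "total_sum (f \<circ> prod.swap) n2 n1 = (\<Sum>i<n1. \<Sum>j<n2. of_bool (f (i, j)))"
    unfolding total_sum_def by (subst sum.swap) simp
  thus "groupie_excess (f \<circ> prod.swap) n2 n1 j > 0 \<Longrightarrow> groupie (bipartite_graph n1 n2 f) (Inr j)"
    and "groupie_excess (f \<circ> prod.swap) n2 n1 j < 0 \<Longrightarrow> \<not> groupie (bipartite_graph n1 n2 f) (Inr j)"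
    using groupie_by_sign[of "bipartite_graph n1 n2 f" "Inr j"] assms
    by (simp_all add: verts_bipartite_graph card_Plus card_edges_bipartite_graph InrI
        neighbor_degree_sum_bipartite_graph degree_bipartite_graph
        groupie_excess_def row_sum_def add.commute)
qed

subsection \<open>Sign of the excess\<close>

text \<open>The row \<open>i' = i\<close> contributes \<open>d\<close> to \<open>r\<close>, because
  indicators are idempotent. Centring the other \<open>a - 1\<close> rows at \<open>p\<close> gives
  \<open>r = d + (a - 1) p d + R\<close>, and \<open>n a p - 2 a b p = p a (a - b)\<close> yields
  the main term.\<close>

lemma groupie_excess_decomposition:
  fixes p :: real
  assumes "i < a"
  shows "groupie_excess f a b i =
     row_sum f b i * (real (a + b) * (1 - p) + p * real a * (real a - real b)
                      - 2 * (total_sum f a b - real a * real b * p))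
     + real (a + b) * (\<Sum>(i', j)\<in>({..<a} - {i}) \<times> {..<b}. of_bool (f (i, j)) * (of_bool (f (i', j)) - p))"
proof -
  let ?I = "{..<a} - {i}"
  let ?X = "\<lambda>i j. of_bool (f (i, j)) :: real"
  let ?S = "\<Sum>j<b. ?X i j * (\<Sum>i'\<in>?I. ?X i' j)"
  have card: "real (card ?I) = real a - 1"
    using assms by simp
  have "(\<Sum>i'<a. ?X i' j) = ?X i j + (\<Sum>i'\<in>?I. ?X i' j)" for j
    using assms by (subst sum.remove[of _ i]) auto
  hence "(\<Sum>j<b. ?X i j * (\<Sum>i'<a. ?X i' j)) = (\<Sum>j<b. ?X i j + ?X i j * (\<Sum>i'\<in>?I. ?X i' j))"
    by (auto intro!: sum.cong simp: algebra_simps)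
  hence 1: "(\<Sum>j<b. ?X i j * (\<Sum>i'<a. ?X i' j)) = row_sum f b i + ?S"
    by (simp add: row_sum_def sum.distrib)
  have "(\<Sum>(i', j)\<in>?I \<times> {..<b}. ?X i j * (?X i' j - p)) = (\<Sum>j<b. \<Sum>i'\<in>?I. ?X i j * (?X i' j - p))"
    by (simp only: sum.cartesian_product[symmetric]) (rule sum.swap)
  also have "\<dots> = (\<Sum>j<b. ?X i j * (\<Sum>i'\<in>?I. ?X i' j) - (real a - 1) * p * ?X i j)"
    by (intro sum.cong refl) (simp only: sum_distrib_left[symmetric] sum_subtractf sum_constant card,
        simp add: algebra_simps)
  also have "\<dots> = ?S - (real a - 1) * p * row_sum f b i"
    by (simp add: row_sum_def sum_subtractf sum_distrib_left)
  finally have 2: "(\<Sum>(i', j)\<in>?I \<times> {..<b}. ?X i j * (?X i' j - p)) = ?S - (real a - 1) * p * row_sum f b i" .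
  show ?thesis
    unfolding groupie_excess_def 1 2 by (simp add: algebra_simps)
qed

text \<open>\<open>T\<close> is the size of the main term. The errors \<open>u\<close> and
  \<open>2 * E\<close> each take at most a quarter of it, so the bracket keeps the sign of
  \<open>a - b\<close> and size at least \<open>T / 2\<close>. Times \<open>d > b * p / 2\<close>
  this is at least \<open>b * p * T / 4\<close>, which exceeds
  \<open>\<bar>n * R\<bar>\<close>.\<close>

lemma sign_of_perturbed_product:
  fixes a b d E R n p u :: real
  defines "T \<equiv> p * a * \<bar>a - b\<bar>"
  assumes "p > 0" "a > 0" "b > 0" "a \<noteq> b"
    and u: "0 \<le> u" "u \<le> T / 4" and E: "\<bar>E\<bar> < T / 8" and d: "d > b * p / 2"
    and n: "n > 0" and R: "\<bar>R\<bar> < b * p * T / (4 * n)"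
  shows "(d * (u + p * a * (a - b) - 2 * E) + n * R) * (a - b) > 0"
proof -
  have T: "T > 0" using assms by (simp add: T_def)
  have "n * \<bar>R\<bar> < b * p * T / 4"
    using R n by (simp add: field_simps)
  hence nR: "\<bar>n * R\<bar> < b * p * T / 4"
    using n by (simp add: abs_mult)
  have d0: "d \<ge> 0" using d \<open>p > 0\<close> \<open>b > 0\<close> mult_pos_pos[of b p] by linarith
  have dB: "b * p * T / 4 \<le> d * B" if "B \<ge> T / 2" for B
    using mult_mono[of "b * p / 2" d "T / 2" B] that d d0 T \<open>p > 0\<close> \<open>b > 0\<close> by simp
  show ?thesis
  proof (cases "a > b")
    case True
    hence "p * a * (a - b) = T" by (simp add: T_def)
    hence "u + p * a * (a - b) - 2 * E \<ge> T / 2"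
      using u E T by linarith
    from dB[OF this] nR True show ?thesis by (intro mult_pos_pos) auto
  next
    case False
    hence "p * a * (a - b) = - T" using assms by (simp add: T_def algebra_simps)
    hence "- (u + p * a * (a - b) - 2 * E) \<ge> T / 2"
      using u E T by linarith
    from dB[OF this] have "d * (u + p * a * (a - b) - 2 * E) \<le> - (b * p * T / 4)"
      unfolding mult_minus_right by linarith
    with nR False \<open>a \<noteq> b\<close> show ?thesis by (intro mult_neg_neg) auto
  qed
qed

text \<open>A wrong sign forces the degree, the number of edges or \<open>R\<close> to deviate too
  far. The three Chebyshev bounds have numerators 4, 128 and 80, which add up to 212.\<close>

lemma prob_wrong_sign:
  fixes p K :: real
  assumes p: "0 < p" "p < 1" and K: "12 \<le> p * K"
    and a: "K \<le> real a" and b: "K \<le> real b" and D: "K \<le> \<bar>real a - real b\<bar>" and i: "i < a"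
  shows "measure_pmf.prob (bernoulli_field ({..<a} \<times> {..<b}) p)
           {f. groupie_excess f a b i * (real a - real b) \<le> 0} \<le> 212 / (p ^ 4 * K)"
proof -
  define D where "D = \<bar>real a - real b\<bar>"
  define n where "n = real (a + b)"
  define T where "T = p * real a * D"
  let ?P = "measure_pmf.prob (bernoulli_field ({..<a} \<times> {..<b}) p)"
  let ?R = "\<lambda>f. \<Sum>(i', j)\<in>({..<a} - {i}) \<times> {..<b}. of_bool (f (i, j)) * (of_bool (f (i', j)) - p)"
  have "K > 0" using p K by (smt (verit) mult_nonneg_nonpos)
  hence "p * K \<le> K" using p by simp
  hence K1: "K \<ge> 1" using K by linarith
  have pos: "real a \<ge> 1" "real b \<ge> 1" "D \<ge> 1" "n > 0" "T > 0" and KD: "K \<le> D"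
    using a b D K1 p by (auto simp: D_def n_def T_def)
  have KD2: "K \<le> D\<^sup>2"
    using mult_mono[of 1 D K D] K1 KD by (simp add: power2_eq_square)
  \<comment> \<open>The next three bounds trade a factor \<open>K\<close> for \<open>a\<close>,
    \<open>D\<close> or \<open>a * b\<close>, using \<open>b \<le> a + D\<close>. They serve, in
    this order, the deterministic error \<open>u\<close>, the edge count and
    \<open>R\<close>.\<close>
  have bnd1: "K * n \<le> 3 * real a * D"
  proof -
    have "K * n \<le> K * (2 * real a + D)"
      using K1 by (intro mult_left_mono) (auto simp: n_def D_def)
    also have "\<dots> = 2 * (K * a) + K * D" by (simp add: algebra_simps)
    also have "\<dots> \<le> 2 * (D * a) + a * D"
      using KD a pos K1 by (intro add_mono mult_mono) auto
    finally show ?thesis by (simp add: algebra_simps)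
  qed
  have bnd2: "K * b \<le> 2 * a * D\<^sup>2"
  proof -
    have "K * b \<le> K * (a + D)"
      using K1 by (intro mult_left_mono) (auto simp: D_def)
    also have "\<dots> = K * a + K * D" by (simp add: algebra_simps)
    also have "\<dots> \<le> D\<^sup>2 * a + a * D\<^sup>2"
      using KD2 a pos K1 by (intro add_mono mult_mono) (auto simp: power2_eq_square)
    finally show ?thesis by (simp add: algebra_simps)
  qed
  have bnd3: "K * n\<^sup>2 \<le> 5 * a * b * D\<^sup>2"
  proof -
    have ab: "K \<le> real a * real b"
      using a pos K1 mult_mono[of K "real a" 1 "real b"] by simp
    \<comment> \<open>This is \<open>(a + b)^2 = 4 a b + (a - b)^2\<close>.\<close>
    have "K * n\<^sup>2 = 4 * (K * (a * b)) + K * D\<^sup>2"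
      by (simp add: n_def D_def power2_eq_square algebra_simps)
    also have "\<dots> \<le> 4 * (D\<^sup>2 * (a * b)) + (a * b) * D\<^sup>2"
      using KD2 K1 ab by (intro add_mono mult_left_mono mult_right_mono) auto
    finally show ?thesis by (simp add: algebra_simps)
  qed
  have u: "n * (1 - p) \<le> T / 4"
  proof -
    have "12 * (n * (1 - p)) \<le> 12 * n"
      using pos p by (simp add: algebra_simps)
    also have "\<dots> \<le> p * K * n"
      using K pos by (intro mult_right_mono) auto
    also have "\<dots> = p * (K * n)" by simp
    also have "\<dots> \<le> p * (3 * real a * D)"
      using bnd1 p by (intro mult_left_mono) auto
    also have "\<dots> = 3 * T" by (simp add: T_def)
    finally show ?thesis by linarith
  qed
  \<comment> \<open>The tail of \<open>R\<close> carries \<open>p ^ 4\<close>; the other two, with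
    \<open>p\<^sup>2\<close>, are weakened to the same denominator.\<close>
  have p24: "p ^ 4 \<le> p\<^sup>2" using p by (intro power_decreasing) auto
  have tail: "?P {f. \<bar>\<Sum>x\<in>A. w x f * (of_bool (f x) - p)\<bar> \<ge> t} \<le> real (card A) / t\<^sup>2"
    if "A \<subseteq> {..<a} \<times> {..<b}" "t > 0" "\<And>x y f b. x \<in> A \<Longrightarrow> y \<in> A \<Longrightarrow> w x (f(y := b)) = w x f"
      "\<And>x f. \<bar>w x f\<bar> \<le> 1" for A t and w :: "_ \<Rightarrow> _ \<Rightarrow> real"
    by (rule weighted_centred_sum_tail) (use that p in auto)

  have P1: "?P {f. \<bar>row_sum f b i - b * p\<bar> \<ge> b * p / 2} \<le> 4 / (p ^ 4 * K)"
  proof -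
    have "(\<Sum>x\<in>{i} \<times> {..<b}. 1 * (of_bool (f x) - p)) = row_sum f b i - b * p" for f
      by (simp add: row_sum_def sum_subtractf sum.cartesian_product')
    hence "?P {f. \<bar>row_sum f b i - b * p\<bar> \<ge> b * p / 2} \<le> real (card ({i} \<times> {..<b})) / (b * p / 2)\<^sup>2"
      using tail[of "{i} \<times> {..<b}" "b * p / 2" "\<lambda>_ _. 1"] i p pos by auto
    also have "\<dots> = 4 / (p\<^sup>2 * b)" using pos by (simp add: power2_eq_square)
    also have "\<dots> \<le> 4 / (p ^ 4 * K)"
      using p p24 b K1 pos by (intro divide_left_mono mult_mono mult_pos_pos) auto
    finally show ?thesis .
  qed
  have P2: "?P {f. \<bar>total_sum f a b - a * b * p\<bar> \<ge> T / 8} \<le> 128 / (p ^ 4 * K)"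
  proof -
    have "(\<Sum>x\<in>{..<a} \<times> {..<b}. 1 * (of_bool (f x) - p)) = total_sum f a b - a * b * p" for f
      by (simp only: total_sum_def sum.cartesian_product case_prod_unfold prod.collapse)
        (simp add: sum_subtractf del: sum_of_bool_eq)
    hence "?P {f. \<bar>total_sum f a b - a * b * p\<bar> \<ge> T / 8} \<le> real (card ({..<a} \<times> {..<b})) / (T / 8)\<^sup>2"
      using tail[of "{..<a} \<times> {..<b}" "T / 8" "\<lambda>_ _. 1"] pos by simp
    also have "\<dots> = 64 * b / (p\<^sup>2 * (a * D\<^sup>2))"
      using pos p by (simp add: T_def power2_eq_square field_simps)
    also have "\<dots> \<le> 128 / (p\<^sup>2 * K)"
      using bnd2 pos p K1 by (simp add: field_simps)
    also have "\<dots> \<le> 128 / (p ^ 4 * K)"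
      using p p24 K1 by (intro divide_left_mono mult_mono mult_pos_pos) auto
    finally show ?thesis .
  qed
  have P3: "?P {f. \<bar>?R f\<bar> \<ge> b * p * T / (4 * n)} \<le> 80 / (p ^ 4 * K)"
  proof -
    \<comment> \<open>The weight at \<open>(i', j)\<close> is the entry \<open>f (i, j)\<close> of
      row \<open>i\<close>. As \<open>?A\<close> omits that row, the weights ignore all coordinates
      in \<open>?A\<close>.\<close>
    let ?A = "({..<a} - {i}) \<times> {..<b}"
    have eq: "(\<Sum>x\<in>?A. of_bool (f (i, snd x)) * (of_bool (f x) - p)) = ?R f" for f
      by (simp add: case_prod_unfold)
    have "?P {f. \<bar>\<Sum>x\<in>?A. of_bool (f (i, snd x)) * (of_bool (f x) - p)\<bar> \<ge> b * p * T / (4 * n)}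
        \<le> real (card ?A) / (b * p * T / (4 * n))\<^sup>2"
      using pos p by (intro tail) auto
    hence "?P {f. \<bar>?R f\<bar> \<ge> b * p * T / (4 * n)} \<le> real (card ?A) / (b * p * T / (4 * n))\<^sup>2"
      by (simp only: eq)
    also have "\<dots> \<le> real (a * b) / (b * p * T / (4 * n))\<^sup>2"
      using card_mono[of "{..<a} \<times> {..<b}" ?A] by (intro divide_right_mono) (auto simp flip: of_nat_mult)
    also have "\<dots> = 16 * n\<^sup>2 / (p ^ 4 * (a * b * D\<^sup>2))"
      using pos p by (simp add: T_def field_simps power2_eq_square power4_eq_xxxx)
    also have "\<dots> \<le> 80 / (p ^ 4 * K)"
      using bnd3 pos p K1 by (simp add: field_simps)
    finally show ?thesis .
  qed

  let ?S1 = "{f. \<bar>row_sum f b i - b * p\<bar> \<ge> b * p / 2}"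
  let ?S2 = "{f. \<bar>total_sum f a b - a * b * p\<bar> \<ge> T / 8}"
  let ?S3 = "{f. \<bar>?R f\<bar> \<ge> b * p * T / (4 * n)}"
  have "f \<in> ?S1 \<union> ?S2 \<union> ?S3" if neg: "groupie_excess f a b i * (real a - real b) \<le> 0" for f
  proof (rule ccontr)
    assume "f \<notin> ?S1 \<union> ?S2 \<union> ?S3"
    hence "\<bar>row_sum f b i - b * p\<bar> < b * p / 2" "\<bar>total_sum f a b - a * b * p\<bar> < T / 8"
      "\<bar>?R f\<bar> < b * p * T / (4 * n)" by auto
    moreover from this(1) have "row_sum f b i > b * p / 2" by linarith
    ultimately have "(row_sum f b i * (n * (1 - p) + p * a * (real a - b) - 2 * (total_sum f a b - a * b * p))
             + n * ?R f) * (real a - b) > 0"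
      using pos p u by (intro sign_of_perturbed_product) (auto simp: T_def D_def)
    hence "groupie_excess f a b i * (real a - b) > 0"
      unfolding groupie_excess_decomposition[OF i, of f b p] n_def by simp
    thus False using neg by simp
  qed
  hence "?P {f. groupie_excess f a b i * (real a - real b) \<le> 0} \<le> ?P (?S1 \<union> ?S2 \<union> ?S3)"
    by (intro measure_pmf.finite_measure_mono) auto
  also have "\<dots> \<le> ?P ?S1 + ?P ?S2 + ?P ?S3"
    by (intro order_trans[OF measure_Un_le] add_right_mono measure_Un_le) auto
  also have "\<dots> \<le> 4 / (p ^ 4 * K) + 128 / (p ^ 4 * K) + 80 / (p ^ 4 * K)"
    by (intro add_mono P1 P2 P3)
  finally show ?thesis by (simp add: add_divide_distrib[symmetric])
qed

subsection \<open>Counting the exceptional vertices\<close>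

text \<open>A vertex is exceptional unless its excess has strictly the sign of its own part size
  minus the other one. Excess 0 counts as exceptional, which covers isolated vertices.\<close>

definition num_exceptional :: "nat \<Rightarrow> nat \<Rightarrow> (nat \<times> nat \<Rightarrow> bool) \<Rightarrow> real" where
  "num_exceptional n1 n2 f =
     (\<Sum>i<n1. of_bool (groupie_excess f n1 n2 i * (real n1 - real n2) \<le> 0)) +
     (\<Sum>j<n2. of_bool (groupie_excess (f \<circ> prod.swap) n2 n1 j * (real n2 - real n1) \<le> 0))"

lemma num_groupies_bipartite_graph:
  "real (num_groupies (bipartite_graph n1 n2 f)) =
     (\<Sum>i<n1. of_bool (groupie (bipartite_graph n1 n2 f) (Inl i))) +
     (\<Sum>j<n2. of_bool (groupie (bipartite_graph n1 n2 f) (Inr j)))"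
proof -
  let ?G = "bipartite_graph n1 n2 f"
  have "{v \<in> verts ?G. groupie ?G v} =
      {i \<in> {..<n1}. groupie ?G (Inl i)} <+> {j \<in> {..<n2}. groupie ?G (Inr j)}"
    by (auto simp: verts_bipartite_graph)
  thus ?thesis
    by (simp add: num_groupies_def card_Plus sum.If_cases of_bool_def Int_def)
qed

text \<open>A vertex that is not exceptional is a groupie exactly if it lies in the larger part.
  Each exceptional vertex changes the count by at most 1.\<close>

lemma num_groupies_close_to_max:
  assumes "n1 \<noteq> n2"
  shows "\<bar>real (num_groupies (bipartite_graph n1 n2 f)) - max (real n1) (real n2)\<bar> \<le> num_exceptional n1 n2 f"
proof -
  let ?l = "\<lambda>i. of_bool (groupie (bipartite_graph n1 n2 f) (Inl i)) :: real"
  let ?r = "\<lambda>j. of_bool (groupie (bipartite_graph n1 n2 f) (Inr j)) :: real"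
  let ?el = "\<lambda>i. of_bool (groupie_excess f n1 n2 i * (real n1 - real n2) \<le> 0) :: real"
  let ?er = "\<lambda>j. of_bool (groupie_excess (f \<circ> prod.swap) n2 n1 j * (real n2 - real n1) \<le> 0) :: real"
  have l: "\<bar>?l i - of_bool (n1 > n2)\<bar> \<le> ?el i" if "i < n1" for i
    using groupie_bipartite_graph_Inl[OF that, where f = f and ?n2.0 = n2] assms
    by (auto simp: of_bool_def mult_le_0_iff not_le)
  have r: "\<bar>?r j - of_bool (n2 > n1)\<bar> \<le> ?er j" if "j < n2" for j
    using groupie_bipartite_graph_Inr[OF that, where f = f and ?n1.0 = n1] assms
    by (auto simp: of_bool_def mult_le_0_iff not_le)
  have "max (real n1) (real n2) = (\<Sum>i<n1. of_bool (n1 > n2)) + (\<Sum>j<n2. of_bool (n2 > n1))"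
    using assms by (auto simp: max_def)
  hence "real (num_groupies (bipartite_graph n1 n2 f)) - max (real n1) (real n2) =
      (\<Sum>i<n1. ?l i - of_bool (n1 > n2)) + (\<Sum>j<n2. ?r j - of_bool (n2 > n1))"
    by (simp add: num_groupies_bipartite_graph sum_subtractf)
  also have "\<bar>\<dots>\<bar> \<le> (\<Sum>i<n1. \<bar>?l i - of_bool (n1 > n2)\<bar>) + (\<Sum>j<n2. \<bar>?r j - of_bool (n2 > n1)\<bar>)"
    by (intro order_trans[OF abs_triangle_ineq] add_mono sum_abs)
  also have "\<dots> \<le> num_exceptional n1 n2 f"
    unfolding num_exceptional_def using l r by (intro add_mono sum_mono) auto
  finally show ?thesis .
qed

text \<open>Reindexing independent, identically distributed entries by a bijection preserves their
  law. This carries the estimate for rows over to columns.\<close>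

lemma bernoulli_field_swap:
  fixes a b :: nat
  shows "bernoulli_field ({..<b} \<times> {..<a}) p =
     map_pmf (\<lambda>f. f \<circ> prod.swap) (bernoulli_field ({..<a} \<times> {..<b}) p)"
  by (rule Pi_pmf_bij_betw) (auto simp: bij_betw_def)

text \<open>By linearity the expected number of exceptional vertices is at most
  \<open>n1 + n2\<close> times the bound for one vertex; Markov's inequality then gives the
  tail.\<close>

lemma prob_num_exceptional_ge:
  fixes p K t :: real
  assumes p: "0 < p" "p < 1" and K: "12 \<le> p * K" and t: "t > 0"
    and n: "K \<le> real n1" "K \<le> real n2" "K \<le> \<bar>real n1 - real n2\<bar>"
  shows "measure_pmf.prob (bernoulli_field ({..<n1} \<times> {..<n2}) p)
           {f. num_exceptional n1 n2 f \<ge> t} \<le> real (n1 + n2) * (212 / (p ^ 4 * K)) / t"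
proof -
  let ?M = "bernoulli_field ({..<n1} \<times> {..<n2}) p"
  let ?E = "measure_pmf.expectation ?M"
  let ?\<delta> = "212 / (p ^ 4 * K)"
  have int: "integrable (measure_pmf ?M) F" for F :: "_ \<Rightarrow> real"
    by (intro integrable_measure_pmf_finite finite_set_bernoulli_field) auto
  have E_of_bool: "?E (\<lambda>f. of_bool (Q f)) = measure_pmf.prob ?M {f. Q f}" for Q
  proof -
    have "(\<lambda>f. of_bool (Q f)) = (indicator {f. Q f} :: _ \<Rightarrow> real)"
      by (auto simp: indicator_def)
    thus ?thesis by simp
  qed
  have l: "?E (\<lambda>f. of_bool (groupie_excess f n1 n2 i * (real n1 - real n2) \<le> 0)) \<le> ?\<delta>" if "i < n1" for i
    unfolding E_of_bool using p K n that by (intro prob_wrong_sign)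
  have r: "?E (\<lambda>f. of_bool (groupie_excess (f \<circ> prod.swap) n2 n1 j * (real n2 - real n1) \<le> 0)) \<le> ?\<delta>"
    if "j < n2" for j
  proof -
    have "measure_pmf.prob (bernoulli_field ({..<n2} \<times> {..<n1}) p)
            {f. groupie_excess f n2 n1 j * (real n2 - real n1) \<le> 0} \<le> ?\<delta>"
      using p K n that by (intro prob_wrong_sign) auto
    thus ?thesis
      unfolding E_of_bool by (simp add: bernoulli_field_swap[of n2 n1] vimage_def)
  qed
  have "?E (num_exceptional n1 n2) \<le> (\<Sum>i<n1. ?\<delta>) + (\<Sum>j<n2. ?\<delta>)"
    unfolding num_exceptional_def
    by (simp only: Bochner_Integration.integral_add Bochner_Integration.integral_sum int)
       (use l r in \<open>intro add_mono sum_mono; simp\<close>)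
  also have "\<dots> = real (n1 + n2) * ?\<delta>"
    by (simp only: sum_constant card_lessThan of_nat_add distrib_right)
  finally have "?E (num_exceptional n1 n2) / t \<le> real (n1 + n2) * ?\<delta> / t"
    using t by (intro divide_right_mono) auto
  moreover have "measure_pmf.prob ?M {f \<in> space (measure_pmf ?M). num_exceptional n1 n2 f \<ge> t}
      \<le> ?E (num_exceptional n1 n2) / t"
    using t by (intro integral_Markov_inequality_measure[where A = "{}"] int)
      (auto simp: num_exceptional_def intro!: sum_nonneg add_nonneg_nonneg)
  ultimately show ?thesis by simp
qed

section \<open>Passage to the limit\<close>

text \<open>Dividing through by \<open>y k\<close> gives a continuous function of
  \<open>x k / y k\<close>, and \<open>max \<alpha> 1 = 1\<close>.\<close>

lemma max_fraction_tendsto: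
  fixes x y :: "nat \<Rightarrow> real"
  assumes "\<And>k. y k > 0" "(\<lambda>k. x k / y k) \<longlonglongrightarrow> \<alpha>" "0 \<le> \<alpha>" "\<alpha> \<le> 1"
  shows "(\<lambda>k. max (x k) (y k) / (x k + y k)) \<longlonglongrightarrow> 1 / (1 + \<alpha>)"
proof -
  have "(\<lambda>k. max (x k / y k) 1 / (x k / y k + 1)) \<longlonglongrightarrow> max \<alpha> 1 / (\<alpha> + 1)"
    using assms by (intro tendsto_intros) auto
  moreover have "max (x k / y k) 1 / (x k / y k + 1) = max (x k) (y k) / (x k + y k)" for k
    using assms(1)[of k] by (auto simp: max_def field_simps)
  ultimately show ?thesis
    using assms by (simp add: max_def add.commute split: if_splits)
qed

theorem theorem4:
  fixes p \<alpha> \<epsilon> :: real and n1 n2 :: "nat \<Rightarrow> nat"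
  assumes "0 < p" and "p < 1"
    and "0 \<le> \<alpha>" and "\<alpha> \<le> 1"
    and "\<And>k. n1 k > 0" and "\<And>k. n2 k > 0"
    and "filterlim n1 at_top sequentially"
    and "filterlim n2 at_top sequentially"
    and "(\<lambda>k. real (n1 k) / real (n2 k)) \<longlonglongrightarrow> \<alpha>"
    and "filterlim (\<lambda>k. \<bar>real (n1 k) - real (n2 k)\<bar>) at_top sequentially"
    and "\<epsilon> > 0"
  shows "(\<lambda>k. measure_pmf.prob (random_bipartite (n1 k) (n2 k) p)
            {G. \<bar>real (num_groupies G) / real (n1 k + n2 k) - 1 / (1 + \<alpha>)\<bar> > \<epsilon>})
         \<longlonglongrightarrow> 0"
proof (rule order_tendstoI)
  fix \<eta> :: real
  assume "\<eta> < 0"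
  thus "\<forall>\<^sub>F k in sequentially. \<eta> < measure_pmf.prob (random_bipartite (n1 k) (n2 k) p)
      {G. \<bar>real (num_groupies G) / real (n1 k + n2 k) - 1 / (1 + \<alpha>)\<bar> > \<epsilon>}"
    by (intro always_eventually allI less_le_trans[OF _ measure_nonneg])
next
  fix \<eta> :: real
  assume \<eta>: "0 < \<eta>"
  note p = assms(1,2) and \<epsilon> = assms(11)
  \<comment> \<open>The first summand secures \<open>12 \<le> p * K\<close>; the second makes the
    final bound \<open>424 / (p ^ 4 * \<epsilon>) / K\<close> smaller than
    \<open>\<eta>\<close>.\<close>
  define K where "K = 12 / p + 424 / (p ^ 4 * \<epsilon> * \<eta>)"
  have K: "12 \<le> p * K" "K > 0" and K_gt: "K > 424 / (p ^ 4 * \<epsilon> * \<eta>)"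
    using p \<eta> \<epsilon> by (auto simp: K_def distrib_left add_pos_pos)
  have real_at_top: "filterlim (\<lambda>k. real (m k)) at_top sequentially"
    if "filterlim m at_top sequentially" for m
    by (rule filterlim_compose[OF filterlim_real_sequentially that])
  have "(\<lambda>k. max (real (n1 k)) (real (n2 k)) / (real (n1 k) + real (n2 k))) \<longlonglongrightarrow> 1 / (1 + \<alpha>)"
    using assms by (intro max_fraction_tendsto) auto
  \<comment> \<open>Half of \<open>\<epsilon>\<close> goes to the deterministic limit, the other
    half to the random deviation from the larger part size.\<close>
  hence "\<forall>\<^sub>F k in sequentially.
      dist (max (real (n1 k)) (real (n2 k)) / (real (n1 k) + real (n2 k))) (1 / (1 + \<alpha>)) < \<epsilon> / 2"
    using \<epsilon> by (intro tendstoD) auto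
  moreover have "\<forall>\<^sub>F k in sequentially. K \<le> real (n1 k)" "\<forall>\<^sub>F k in sequentially. K \<le> real (n2 k)"
    "\<forall>\<^sub>F k in sequentially. K \<le> \<bar>real (n1 k) - real (n2 k)\<bar>"
    using real_at_top[OF assms(7)] real_at_top[OF assms(8)] assms(10)
    unfolding filterlim_at_top by blast+
  ultimately show "\<forall>\<^sub>F k in sequentially. measure_pmf.prob (random_bipartite (n1 k) (n2 k) p)
      {G. \<bar>real (num_groupies G) / real (n1 k + n2 k) - 1 / (1 + \<alpha>)\<bar> > \<epsilon>} < \<eta>"
  proof eventually_elim
    case (elim k)
    let ?n = "real (n1 k + n2 k)"
    let ?M = "bernoulli_field ({..<n1 k} \<times> {..<n2 k}) p"
    let ?N = "\<lambda>f. real (num_groupies (bipartite_graph (n1 k) (n2 k) f))"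
    let ?m = "max (real (n1 k)) (real (n2 k))"
    have n_pos: "?n > 0" using assms(5)[of k] by simp
    have ne: "n1 k \<noteq> n2 k" using elim(4) K(2) by auto
    have "num_exceptional (n1 k) (n2 k) f \<ge> ?n * \<epsilon> / 2" if "\<bar>?N f / ?n - 1 / (1 + \<alpha>)\<bar> > \<epsilon>" for f
    proof -
      have "\<bar>?N f / ?n - ?m / ?n\<bar> > \<epsilon> / 2"
        using that elim(1) unfolding dist_real_def of_nat_add by linarith
      hence "\<bar>?N f - ?m\<bar> / ?n > \<epsilon> / 2"
        by (simp add: diff_divide_distrib[symmetric] abs_divide)
      hence "\<bar>?N f - ?m\<bar> > ?n * \<epsilon> / 2" using n_pos by (simp add: field_simps)
      thus ?thesis using num_groupies_close_to_max[OF ne, of f] by linarith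
    qed
    hence "measure_pmf.prob (random_bipartite (n1 k) (n2 k) p)
        {G. \<bar>real (num_groupies G) / ?n - 1 / (1 + \<alpha>)\<bar> > \<epsilon>}
        \<le> measure_pmf.prob ?M {f. num_exceptional (n1 k) (n2 k) f \<ge> ?n * \<epsilon> / 2}"
      unfolding random_bipartite_def measure_map_pmf
      by (intro measure_pmf.finite_measure_mono) auto
    also have "\<dots> \<le> ?n * (212 / (p ^ 4 * K)) / (?n * \<epsilon> / 2)"
      using p K elim n_pos \<epsilon> by (intro prob_num_exceptional_ge) auto
    \<comment> \<open>The number of vertices cancels: its factor in the expectation meets the
      threshold \<open>?n * \<epsilon> / 2\<close>, which is linear in it.\<close>
    also have "?n * (212 / (p ^ 4 * K)) / (?n * \<epsilon> / 2) = 424 / (p ^ 4 * \<epsilon>) / K"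
    proof -
      have "x * (212 / (p ^ 4 * K)) / (x * \<epsilon> / 2) = 424 / (p ^ 4 * \<epsilon>) / K" if "x > 0" for x
        using that by simp
      from this[OF n_pos] show ?thesis .
    qed
    also have "\<dots> < \<eta>"
      using K_gt K(2) \<eta> \<epsilon> p by (simp add: field_simps)
    finally show ?case .
  qed
qed

end
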